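(* Let $\Sigma$ be a finite subset of $\mathbf{N}^*$ such that $|\Sigma|<q$, and let $n\in\mathbf{N}$. For all $d\in\mathbf{N}$, $$S_d\begin{pmatrix}\Sigma\\ n+1\end{pmatrix}=S_d(n+1)\,b_d(\Sigma)+\sum_{\substack{J\subsetneq\Sigma\\ I\sqcup J=\Sigma}}\ \sum_{\substack{0\le k_i\le d-1,\ i\in I\\ n-\sum_{i\in I}q^{k_i}+1>0}}S_d\Big(n-\sum_{i\in I}q^{k_i}+1\Big)\Big(\prod_{i\in I}Q_{d,k_i}(t_i)\Big)b_d(J).$$
   Context: $\mathbf{N}$ is the set of non-negative integers, $\mathbf{N}^*$ the positive integers, $\mathbf{F}_q$ a finite field with $q$ elements, $A=\mathbf{F}_q[\theta]$, $A^+(d)$ the set of monic polynomials in $A$ of degree $d$, and $(t_i)_{i\in\mathbf{N}^*}$ independent indeterminates. Empty products equal $1$ and empty sums equal $0$. For a finite subset $\Sigma\subset\mathbf{N}^*$ and $a\in A$, $\chi_\Sigma(a)=\prod_{i\in\Sigma}a(t_i)$, where $a(t_i)$ is obtained by replacing $\theta$ with $t_i$. For a positive integer $s$ and $d\in\mathbf{N}$, $$S_d(s)=\sum_{a\in A^+(d)}\frac1{a^s},\qquad S_d\begin{pmatrix}\Sigma\\ s\end{pmatrix}=\sum_{a\in A^+(d)}\frac{\chi_\Sigma(a)}{a^s}.$$ Put $\ell_d=\prod_{i=1}^d(\theta-\theta^{q^i})$, $D_d=\prod_{i=0}^{d-1}(\theta^{q^d}-\theta^{q^i})$, $b_d(t)=\prod_{i=0}^{d-1}(t-\theta^{q^i})$,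 $b_d(\Sigma)=\prod_{i\in\Sigma}b_d(t_i)$, and, for $d\ge1$ and $0\le k\le d-1$, $$Q_{d,k}(t)=\sum_{j=k}^{d-1}\frac{b_j(t)}{D_k\,\ell_{j-k}^{q^k}}.$$ $I\sqcup J=\Sigma$ means $\Sigma$ is the disjoint union of $I$ and $J$. The inner sum runs over families $(k_i)_{i\in I}$ of integers satisfying the stated conditions. *)

theory Defs
  imports
    "HOL-Computational_Algebra.Polynomial_Factorial"
    "HOL-Library.Poly_Mapping"
    "HOL-Library.FuncSet"
    "HOL-Library.Cardinality"
begin

text \<open>
  The finite field with q elements is a type \<open>'a :: finite_field\<close> with \<open>q = CARD('a)\<close>.
  Then \<open>A\<close> is \<open>'a poly\<close>, its fraction field \<open>K\<close> is \<open>'a poly fract\<close>, and both sides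
  of the identity live in the polynomial ring over \<open>K\<close> in the independent indeterminates
  \<open>t\<^sub>i\<close>, modelled by finitely supported functions from monomials to coefficients
  with the convolution product.
\<close>

type_synonym 'a Kt = "(nat \<Rightarrow>\<^sub>0 nat) \<Rightarrow>\<^sub>0 'a poly fract"

definition K_const :: "'a::finite_field poly fract \<Rightarrow> 'a Kt" where
  "K_const c = Poly_Mapping.single 0 c"

definition tvar :: "nat \<Rightarrow> 'a::finite_field Kt" where
  "tvar i = Poly_Mapping.single (Poly_Mapping.single i 1) 1"

definition theta :: "'a::finite_field poly fract" where
  "theta = to_fract [:0, 1:]"

definition monics :: "nat \<Rightarrow> 'a::finite_field poly set" where
  "monics d = {a. lead_coeff a = 1 \<and> degree a = d}"

definition subst_theta :: "'a::finite_field poly \<Rightarrow> 'a Kt \<Rightarrow> 'a Kt" where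
  "subst_theta a x = poly (map_poly (\<lambda>c. K_const (to_fract [:c:])) a) x"

definition chi :: "nat set \<Rightarrow> 'a::finite_field poly \<Rightarrow> 'a Kt" where
  "chi \<Sigma> a = (\<Prod>i\<in>\<Sigma>. subst_theta a (tvar i))"

definition power_sum :: "nat \<Rightarrow> nat \<Rightarrow> 'a::finite_field poly fract" where
  "power_sum d s = (\<Sum>a\<in>monics d. 1 / to_fract a ^ s)"

definition power_sum_chi :: "nat \<Rightarrow> nat set \<Rightarrow> nat \<Rightarrow> 'a::finite_field Kt" where
  "power_sum_chi d \<Sigma> s = (\<Sum>a\<in>monics d. K_const (1 / to_fract a ^ s) * chi \<Sigma> a)"

definition carlitz_ell :: "nat \<Rightarrow> 'a::finite_field poly fract" where
  "carlitz_ell d = (\<Prod>i=1..d. theta - theta ^ (CARD('a) ^ i))"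

definition carlitz_D :: "nat \<Rightarrow> 'a::finite_field poly fract" where
  "carlitz_D d = (\<Prod>i<d. theta ^ (CARD('a) ^ d) - theta ^ (CARD('a) ^ i))"

definition b_poly :: "nat \<Rightarrow> 'a::finite_field Kt \<Rightarrow> 'a Kt" where
  "b_poly d x = (\<Prod>i<d. x - K_const (theta ^ (CARD('a) ^ i)))"

definition b_prod :: "nat \<Rightarrow> nat set \<Rightarrow> 'a::finite_field Kt" where
  "b_prod d \<Sigma> = (\<Prod>i\<in>\<Sigma>. b_poly d (tvar i))"

definition Q_poly :: "nat \<Rightarrow> nat \<Rightarrow> 'a::finite_field Kt \<Rightarrow> 'a Kt" where
  "Q_poly d k x = (\<Sum>j\<in>{k..<d}. K_const (1 / (carlitz_D k * carlitz_ell (j - k) ^ (CARD('a) ^ k))) * b_poly j x)"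

text \<open>
  The families \<open>(k\<^sub>i)\<close> indexed by \<open>I\<close> with \<open>0 \<le> k\<^sub>i \<le> d - 1\<close> and
  \<open>n - \<Sum> q^(k\<^sub>i) + 1 > 0\<close>. The latter inequality is over the integers; it says that the
  sum is at most \<open>n\<close>, so the truncated subtraction \<open>n - \<Sum> q^(k\<^sub>i)\<close> on \<open>nat\<close>
  is exact for these families. Extensionality makes each family occur exactly once, and there
  are none when \<open>d = 0\<close> and \<open>I\<close> is nonempty.
\<close>

definition exponent_families :: "nat \<Rightarrow> nat \<Rightarrow> nat \<Rightarrow> nat set \<Rightarrow> (nat \<Rightarrow> nat) set" where
  "exponent_families q d n I =
     {k \<in> I \<rightarrow>\<^sub>E {..<d}. int n - (\<Sum>i\<in>I. int (q ^ k i)) + 1 > 0}"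

text \<open>The sums over monic polynomials are genuine finite sums.\<close>

lemma finite_monics: "finite (monics d :: 'a::finite_field poly set)"
proof (rule finite_subset)
  show "monics d \<subseteq> Poly ` {xs. set xs \<subseteq> (UNIV :: 'a set) \<and> length xs \<le> Suc d}"
  proof
    fix a :: "'a poly" assume "a \<in> monics d"
    then have "length (coeffs a) \<le> Suc d" by (auto simp: monics_def degree_eq_length_coeffs)
    moreover have "a = Poly (coeffs a)" by simp
    ultimately show "a \<in> Poly ` {xs. set xs \<subseteq> (UNIV :: 'a set) \<and> length xs \<le> Suc d}"
      by blast
  qed
  show "finite (Poly ` {xs. set xs \<subseteq> (UNIV :: 'a set) \<and> length xs \<le> Suc d})"
    using finite_lists_length_le[of "UNIV :: 'a set" "Suc d"] by simp
qed

end

theory Submission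
  imports Defs
begin

text \<open>
  For a monic polynomial \<open>a\<close> of degree \<open>d\<close>, the polynomial \<open>a(t) - b\<^sub>d(t)\<close> has degree less than
  \<open>d\<close>, and since Frobenius fixes the coefficients of \<open>a\<close> it takes the value
  \<open>a(\<theta>)^(q^k)\<close> at \<open>t = \<theta>^(q^k)\<close> for each \<open>k < d\<close>. The polynomials \<open>Q\<^sub>d\<^sub>,\<^sub>k\<close> are the Lagrange
  basis for these nodes, written in Newton form (\<open>Q_poly_conv_lagrange_basis\<close>). Hence
  \<open>a(t) = b\<^sub>d(t) + (\<Sum>k<d. a^(q^k) Q\<^sub>d\<^sub>,\<^sub>k(t))\<close> (\<open>subst_theta_monic\<close>).

  Multiplying this identity over \<open>t = t\<^sub>i\<close>, \<open>i \<in> \<Sigma>\<close>, expanding, dividing by \<open>a^(n+1)\<close> and summing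
  over \<open>a\<close> gives the asserted right-hand side, except that families \<open>k\<close> with
  \<open>(\<Sum>i\<in>I. q^(k i)) > n\<close> occur as well. For those, the coefficient is the sum of \<open>a^m\<close> over all
  monic \<open>a\<close> of degree \<open>d\<close>, where \<open>0 \<le> m = (\<Sum>i\<in>I. q^(k i)) - (n + 1)\<close>. As \<open>card I \<le> q - 1\<close> and
  \<open>k i \<le> d - 1\<close>, we have \<open>m < (q - 1) q^(d-1)\<close>, hence \<open>m < q^d - 1\<close>, and in this range
  the power sum vanishes (\<open>sum_monics_power_eq_0\<close>). That is where \<open>card \<Sigma> < q\<close> enters.

  The vanishing comes from base \<open>q\<close> digits: for \<open>m < q^d - 1\<close> the digit sum of \<open>m\<close> is
  less than \<open>d (q - 1)\<close>, so \<open>a^m\<close> is a product of fewer than \<open>d (q - 1)\<close> factors \<open>a^(q^k)\<close>, each an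
  affine function of the \<open>d\<close> free coefficients of \<open>a\<close>. A polynomial of degree less than
  \<open>d (q - 1)\<close> sums to zero over \<open>\<bbbF>\<^sub>q^d\<close>, as in the proof of the Chevalley--Warning theorem.
\<close>

section \<open>Power sums over finite fields and the Frobenius\<close>

lemma finite_field_card_ge_2: "CARD('a::finite_field) \<ge> 2"
proof -
  have "card {0, 1 :: 'a} \<le> CARD('a)" by (intro card_mono) auto
  thus ?thesis by simp
qed

text \<open>
  For \<open>0 < u < q - 1\<close> some nonzero \<open>g\<close> has \<open>g^u \<noteq> 1\<close>, because \<open>X^u - 1\<close> has too few roots, and
  replacing \<open>c\<close> by \<open>g c\<close> multiplies the sum by \<open>g^u\<close>. For \<open>u = 0\<close> the sum is \<open>q = 0\<close>, as
  translation by \<open>1\<close> permutes the field.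
\<close>
lemma sum_finite_field_power_eq_0:
  assumes "u < CARD('a) - 1"
  shows "(\<Sum>c\<in>UNIV. c ^ u :: 'a::finite_field) = 0"
proof (cases "u = 0")
  case True
  have "(\<Sum>c\<in>UNIV. c :: 'a) = (\<Sum>c\<in>UNIV. c + 1)"
    by (rule sum.reindex_bij_witness[of _ "\<lambda>c. c + 1" "\<lambda>c. c - 1"]) auto
  also have "\<dots> = (\<Sum>c\<in>UNIV. c) + of_nat CARD('a)" by (simp add: sum.distrib)
  finally show ?thesis using True by simp
next
  case False
  let ?p = "monom 1 u - 1 :: 'a poly"
  have "\<exists>g::'a. g \<noteq> 0 \<and> g ^ u \<noteq> 1"
  proof (rule ccontr)
    assume "\<not> ?thesis"
    hence "UNIV - {0} \<subseteq> {x. poly ?p x = 0}" by (auto simp: poly_monom)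
    moreover have nz: "?p \<noteq> 0"
    proof
      assume "?p = 0"
      hence "poly ?p 0 = 0" by simp
      thus False using False by (simp add: poly_monom power_0_left)
    qed
    ultimately have "card (UNIV - {0 :: 'a}) \<le> card {x. poly ?p x = 0}"
      by (intro card_mono poly_roots_finite)
    also have "\<dots> \<le> degree ?p" by (rule card_poly_roots_bound[OF nz])
    also have "\<dots> \<le> u" by (intro degree_diff_le degree_monom_le) auto
    finally show False using assms by (simp add: card_Diff_singleton)
  qed
  then obtain g :: 'a where g: "g \<noteq> 0" "g ^ u \<noteq> 1" by blast
  have "(\<Sum>c\<in>UNIV. c ^ u :: 'a) = (\<Sum>c\<in>UNIV. (g * c) ^ u)"
    by (rule sum.reindex_bij_witness[of _ "\<lambda>c. g * c" "\<lambda>c. c / g"]) (use g in auto)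
  also have "\<dots> = g ^ u * (\<Sum>c\<in>UNIV. c ^ u)" by (simp add: power_mult_distrib sum_distrib_left)
  finally have "(1 - g ^ u) * (\<Sum>c\<in>UNIV. c ^ u) = 0" by (simp add: algebra_simps)
  thus ?thesis using g by simp
qed

text \<open>
  These are the coefficients of \<open>(X + 1)^q - X^q - 1\<close>, a polynomial of degree less than \<open>q\<close>
  that vanishes at all \<open>q\<close> elements of the field. This gives additivity of the \<open>q\<close>-th power
  directly, without writing \<open>q\<close> as a power of the characteristic.
\<close>
lemma of_nat_card_choose_eq_0:
  assumes "0 < k" "k < CARD('a)"
  shows "(of_nat (CARD('a) choose k) :: 'a::finite_field) = 0"
proof -
  let ?q = "CARD('a)"
  define P :: "'a poly" where "P = (\<Sum>k\<in>{0<..<?q}. monom (of_nat (?q choose k)) k)"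
  have "P = 0"
  proof (rule poly_eqI_degree[where A = UNIV])
    fix x :: 'a
    have "(x + 1) ^ ?q = (\<Sum>k\<le>?q. of_nat (?q choose k) * x ^ k)"
      by (simp add: binomial_ring)
    also have "{..?q} = insert 0 (insert ?q {0<..<?q})" by auto
    also have "(\<Sum>k\<in>\<dots>. of_nat (?q choose k) * x ^ k) = 1 + (x ^ ?q + poly P x)"
      using finite_field_card_ge_2[where 'a='a]
      by (simp add: P_def poly_sum poly_monom)
    finally show "poly P x = poly 0 x"
      by (simp add: finite_field_power_card_eq_same)
  next
    have "degree P \<le> ?q - 1" unfolding P_def
      by (intro degree_sum_le) (auto intro!: order.trans[OF degree_monom_le])
    thus "degree P < card (UNIV :: 'a set)" using finite_field_card_ge_2[where 'a='a] by linarith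
  qed auto
  hence "coeff P k = 0" by simp
  thus ?thesis using assms by (simp add: P_def coeff_sum)
qed

lemma poly_add_power_card:
  fixes a b :: "'a::finite_field poly"
  shows "(a + b) ^ CARD('a) = a ^ CARD('a) + b ^ CARD('a)"
proof -
  let ?q = "CARD('a)"
  have "(a + b) ^ ?q = (\<Sum>k\<le>?q. of_nat (?q choose k) * a ^ k * b ^ (?q - k))"
    by (rule binomial_ring)
  also have "\<dots> = (\<Sum>k\<in>{0, ?q}. of_nat (?q choose k) * a ^ k * b ^ (?q - k))"
    by (rule sum.mono_neutral_right) (auto simp: of_nat_poly of_nat_card_choose_eq_0)
  also have "\<dots> = a ^ ?q + b ^ ?q" using finite_field_card_ge_2[where 'a='a] by simp
  finally show ?thesis .
qed

lemma poly_add_power_card_power: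
  fixes a b :: "'a::finite_field poly"
  shows "(a + b) ^ (CARD('a) ^ k) = a ^ (CARD('a) ^ k) + b ^ (CARD('a) ^ k)"
  by (induction k) (simp_all add: poly_add_power_card power_mult mult.commute[of "CARD('a)"])

lemma poly_diff_power_card_power:
  fixes a b :: "'a::finite_field poly"
  shows "(a - b) ^ (CARD('a) ^ k) = a ^ (CARD('a) ^ k) - b ^ (CARD('a) ^ k)"
  using poly_add_power_card_power[of "a - b" b k] by simp

lemma smult_power_card_power:
  fixes a :: "'a::finite_field poly"
  shows "smult c a ^ (CARD('a) ^ k) = smult c (a ^ (CARD('a) ^ k))"
  by (simp add: smult_power finite_field_power_card_power_eq_same)

section \<open>Vanishing of power sums of monic polynomials\<close>

lemma smult_sum_right: "smult c (\<Sum>i\<in>S. f i) = (\<Sum>i\<in>S. smult c (f i))"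
  by (induction S rule: infinite_finite_induct) (simp_all add: smult_add_right)

text \<open>
  The degree argument behind the Chevalley--Warning theorem: the product has degree at most
  \<open>card T\<close> in the \<open>d\<close> coefficients of \<open>w\<close>, so in each of its monomials some coefficient has
  exponent below \<open>q - 1\<close>. The induction splits off the top coefficient \<open>c\<close> of \<open>w\<close>: in the part of
  the product where \<open>c\<close> is taken from the factors in \<open>U\<close>, either \<open>card U < q - 1\<close> and the sum
  over \<open>c\<close> vanishes, or few enough factors remain for the induction hypothesis.
\<close>
lemma sum_prod_affine_eq_0:
  fixes \<phi> :: "'j \<Rightarrow> 'a::finite_field poly \<Rightarrow> 'a poly" and x :: "'j \<Rightarrow> 'a poly"
  assumes add: "\<And>j v w. \<phi> j (v + w) = \<phi> j v + \<phi> j w"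
    and smult: "\<And>j c w. \<phi> j (smult c w) = smult c (\<phi> j w)"
    and "finite T" "card T < d * (CARD('a) - 1)"
  shows "(\<Sum>w | \<forall>i\<ge>d. coeff w i = 0. \<Prod>j\<in>T. x j + \<phi> j w) = 0"
  using assms(3,4)
proof (induction d arbitrary: T)
  case (Suc d)
  let ?W = "\<lambda>d. {w :: 'a poly. \<forall>i\<ge>d. coeff w i = 0}"
  have "(\<Sum>w\<in>?W (Suc d). \<Prod>j\<in>T. x j + \<phi> j w) =
        (\<Sum>(w, c)\<in>?W d \<times> UNIV. \<Prod>j\<in>T. x j + \<phi> j (smult c (monom 1 d) + w))"
    by (rule sum.reindex_bij_witness[of _ "\<lambda>(w, c). smult c (monom 1 d) + w"
          "\<lambda>w. (w - smult (coeff w d) (monom 1 d), coeff w d)"])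
       (auto simp: le_Suc_eq not_less_eq_eq dest: le_neq_implies_less)
  also have "\<dots> = (\<Sum>w\<in>?W d. \<Sum>c\<in>UNIV. \<Prod>j\<in>T. smult c (\<phi> j (monom 1 d)) + (x j + \<phi> j w))"
    by (simp add: sum.cartesian_product add smult add_ac)
  also have "\<dots> = (\<Sum>w\<in>?W d. \<Sum>c\<in>UNIV. \<Sum>U\<in>Pow T.
      smult (c ^ card U) (\<Prod>j\<in>U. \<phi> j (monom 1 d)) * (\<Prod>j\<in>T - U. x j + \<phi> j w))"
    using Suc.prems(1) by (simp add: prod_add prod_smult)
  also have "\<dots> = (\<Sum>U\<in>Pow T. \<Sum>w\<in>?W d. \<Sum>c\<in>UNIV.
      smult (c ^ card U) (\<Prod>j\<in>U. \<phi> j (monom 1 d)) * (\<Prod>j\<in>T - U. x j + \<phi> j w))"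
    by (rule trans[OF sum.cong[OF refl sum.swap] sum.swap])
  also have "\<dots> = (\<Sum>U\<in>Pow T. smult (\<Sum>c\<in>UNIV. c ^ card U)
      ((\<Prod>j\<in>U. \<phi> j (monom 1 d)) * (\<Sum>w\<in>?W d. \<Prod>j\<in>T - U. x j + \<phi> j w)))"
    by (simp add: sum_distrib_left smult_sum smult_sum_right)
  also have "\<dots> = 0"
  proof (rule sum.neutral, rule ballI)
    fix U assume U: "U \<in> Pow T"
    show "smult (\<Sum>c\<in>UNIV. c ^ card U)
      ((\<Prod>j\<in>U. \<phi> j (monom 1 d)) * (\<Sum>w\<in>?W d. \<Prod>j\<in>T - U. x j + \<phi> j w)) = 0"
    proof (cases "card U < CARD('a) - 1")
      case True
      thus ?thesis by (simp add: sum_finite_field_power_eq_0)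
    next
      case False
      have "card (T - U) = card T - card U"
        using U Suc.prems(1) by (intro card_Diff_subset) (auto intro: finite_subset)
      moreover have "card U \<le> card T" using U Suc.prems(1) by (intro card_mono) auto
      moreover have "card T < (CARD('a) - 1) + d * (CARD('a) - 1)" using Suc.prems(2) by simp
      ultimately have "card (T - U) < d * (CARD('a) - 1)" using False by linarith
      thus ?thesis using Suc.IH[of "T - U"] Suc.prems(1) by simp
    qed
  qed
  finally show ?case .
qed simp

text \<open>
  The list has each exponent \<open>k\<close> repeated as often as the \<open>k\<close>-th base \<open>q\<close> digit of \<open>m\<close> says. All
  \<open>d\<close> digits equal \<open>q - 1\<close> only for \<open>m = q^d - 1\<close>.
\<close>
lemma sum_of_few_powers:
  fixes q :: nat
  assumes "q \<ge> 2" "m < q ^ d"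
  shows "\<exists>ks. m = (\<Sum>k\<leftarrow>ks. q ^ k) \<and> length ks \<le> d * (q - 1) \<and>
              (m \<noteq> q ^ d - 1 \<longrightarrow> length ks < d * (q - 1))"
  using assms(2)
proof (induction d arbitrary: m)
  case (Suc d)
  have "m div q < q ^ d" using Suc.prems assms(1)
    by (simp add: less_mult_imp_div_less mult.commute)
  from Suc.IH[OF this] obtain ks where ks: "m div q = (\<Sum>k\<leftarrow>ks. q ^ k)"
    "length ks \<le> d * (q - 1)" "m div q \<noteq> q ^ d - 1 \<longrightarrow> length ks < d * (q - 1)" by blast
  have "m mod q < q" using assms(1) by simp
  hence r: "m mod q \<le> q - 1" by linarith
  let ?ks = "map Suc ks @ replicate (m mod q) 0"
  have "m = q * (m div q) + m mod q" by simp
  also have "\<dots> = (\<Sum>k\<leftarrow>?ks. q ^ k)"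
    by (simp add: ks(1) sum_list_const_mult comp_def sum_list_replicate)
  finally have sum: "m = (\<Sum>k\<leftarrow>?ks. q ^ k)" .
  have "length ?ks < Suc d * (q - 1)" if "m \<noteq> q ^ Suc d - 1"
  proof (cases "m div q = q ^ d - 1")
    case True
    have "m mod q \<noteq> q - 1"
    proof
      assume "m mod q = q - 1"
      hence "m = q * (q ^ d - 1) + (q - 1)" using True by (metis mult_div_mod_eq)
      also have "\<dots> = q ^ Suc d - 1"
      proof -
        have "q * q ^ d \<ge> q * 1" using assms(1) by (intro mult_le_mono2) simp
        thus ?thesis using assms(1) by (simp add: diff_mult_distrib2)
      qed
      finally show False using that by simp
    qed
    thus ?thesis using r ks(2) by simp
  next
    case False
    thus ?thesis using r ks(3) by simp
  qed
  moreover have "length ?ks \<le> Suc d * (q - 1)" using r ks(2) by simp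
  ultimately show ?case using sum by blast
qed simp

lemma sum_monics_power_eq_0:
  assumes "m < CARD('a) ^ d - 1"
  shows "(\<Sum>a\<in>monics d. a ^ m :: 'a::finite_field poly) = 0"
proof -
  let ?q = "CARD('a)"
  obtain ks where ks: "m = (\<Sum>k\<leftarrow>ks. ?q ^ k)" "length ks < d * (?q - 1)"
    using sum_of_few_powers[OF finite_field_card_ge_2[where 'a='a], of m d] assms
    by (metis diff_le_self less_le_trans nat_neq_iff)
  have pow: "a ^ m = (\<Prod>j<length ks. a ^ (?q ^ (ks ! j)))" for a :: "'a poly"
  proof -
    have "a ^ m = (\<Prod>k\<leftarrow>ks. a ^ (?q ^ k))" unfolding ks(1)
      by (induction ks) (simp_all add: power_add)
    thus ?thesis by (simp add: prod.list_conv_set_nth atLeast0LessThan)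
  qed
  have "(\<Sum>a\<in>monics d. a ^ m :: 'a poly) =
        (\<Sum>w | \<forall>i\<ge>d. coeff w i = 0. (monom 1 d + w) ^ m)"
  proof (rule sum.reindex_bij_witness[of _ "\<lambda>w. monom 1 d + w" "\<lambda>a. a - monom 1 d"])
    fix a :: "'a poly" assume "a \<in> monics d"
    thus "a - monom 1 d \<in> {w. \<forall>i\<ge>d. coeff w i = 0}"
      by (auto simp: monics_def coeff_eq_0)
  next
    fix w :: "'a poly" assume "w \<in> {w. \<forall>i\<ge>d. coeff w i = 0}"
    hence w: "coeff w i = 0" if "i \<ge> d" for i using that by auto
    have "degree (monom 1 d + w) = d"
    proof (rule antisym)
      show "degree (monom 1 d + w) \<le> d" by (rule degree_le) (simp add: w)
      show "d \<le> degree (monom 1 d + w)" by (rule le_degree) (simp add: w)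
    qed
    thus "monom 1 d + w \<in> monics d" by (simp add: monics_def w)
  qed simp_all
  also have "\<dots> = (\<Sum>w | \<forall>i\<ge>d. coeff w i = 0.
      \<Prod>j<length ks. monom 1 d ^ (?q ^ (ks ! j)) + w ^ (?q ^ (ks ! j)))"
    by (simp add: pow poly_add_power_card_power)
  also have "\<dots> = 0"
    by (rule sum_prod_affine_eq_0)
       (use ks(2) in \<open>simp_all add: poly_add_power_card_power smult_power_card_power\<close>)
  finally show ?thesis .
qed

section \<open>Lagrange interpolation in Newton form\<close>

text \<open>
  Write \<open>L\<^sub>d\<close> for the Lagrange basis polynomial of node \<open>k\<close> among the first \<open>d\<close> nodes. Then
  \<open>L\<^sub>d\<^sub>+\<^sub>1 - L\<^sub>d\<close> is \<open>L\<^sub>d\<close> times \<open>(t - x d) / (x k - x d) - 1 = (t - x k) / (x k - x d)\<close>, which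
  restores the factor \<open>t - x k\<close> missing in \<open>L\<^sub>d\<close>. This difference is the Newton term for
  \<open>j = d\<close>, so the sum telescopes. The inverses \<open>v i\<close> are given explicitly because the ring of
  the application is a polynomial ring, not a field.
\<close>
lemma newton_form_of_lagrange_basis:
  fixes x v :: "nat \<Rightarrow> 'b::comm_ring_1"
  assumes "Suc k \<le> d" and inv: "\<And>i. i \<noteq> k \<Longrightarrow> v i * (x k - x i) = 1"
  shows "(\<Sum>j\<in>{k..<d}. (\<Prod>i\<in>{..j} - {k}. v i) * (\<Prod>i<j. t - x i)) =
         (\<Prod>i\<in>{..<d} - {k}. v i * (t - x i))"
  using assms(1)
proof (induction d rule: dec_induct)
  case base
  have "{..k} - {k} = {..<k}" "{..<Suc k} - {k} = {..<k}" by auto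
  thus ?case by (simp add: prod.distrib)
next
  case (step d)
  let ?L = "\<Prod>i\<in>{..<d} - {k}. v i * (t - x i)"
  have sets: "{..d} - {k} = insert d ({..<d} - {k})" "{..<Suc d} - {k} = insert d ({..<d} - {k})"
    using step.hyps by auto
  have "(\<Prod>i<d. t - x i) = (t - x k) * (\<Prod>i\<in>{..<d} - {k}. t - x i)"
    using step.hyps by (intro prod.remove) auto
  hence "(\<Prod>i\<in>{..d} - {k}. v i) * (\<Prod>i<d. t - x i) = v d * (t - x k) * ?L"
    by (simp add: sets prod.distrib mult_ac)
  hence "(\<Sum>j\<in>{k..<Suc d}. (\<Prod>i\<in>{..j} - {k}. v i) * (\<Prod>i<j. t - x i)) =
      1 * ?L + v d * (t - x k) * ?L"
    using step by simp
  \<comment> \<open>Expanding the coefficient \<open>1\<close> of \<open>L\<^sub>d\<close> merges the two terms into \<open>v d * (t - x d) * L\<^sub>d\<close>.\<close>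
  also have "1 = v d * (x k - x d)" using inv[of d] step.hyps by simp
  also have "v d * (x k - x d) * ?L + v d * (t - x k) * ?L = v d * (t - x d) * ?L"
    by (simp add: algebra_simps)
  finally show ?case by (simp add: sets)
qed

text \<open>
  Both sides are monic of degree \<open>d\<close> in \<open>t\<close> and agree at the \<open>d\<close> distinct nodes.
\<close>
lemma monic_lagrange_interpolation:
  fixes p :: "'b::idom poly" and x :: "nat \<Rightarrow> 'b"
  assumes p: "degree p = d" "lead_coeff p = 1"
    and inv: "\<And>i k. i \<noteq> k \<Longrightarrow> v k i * (x k - x i) = 1"
  shows "poly p t = (\<Prod>i<d. t - x i) +
           (\<Sum>k<d. poly p (x k) * (\<Prod>i\<in>{..<d} - {k}. v k i * (t - x i)))"
proof -
  define B where "B = (\<Prod>i<d. [:- x i, 1:])"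
  define L where "L k = (\<Prod>i\<in>{..<d} - {k}. smult (v k i) [:- x i, 1:])" for k
  define R where "R = B + (\<Sum>k<d. smult (poly p (x k)) (L k))"
  have poly_B: "poly B z = (\<Prod>i<d. z - x i)" for z by (simp add: B_def poly_prod)
  have poly_L: "poly (L k) z = (\<Prod>i\<in>{..<d} - {k}. v k i * (z - x i))" for k z
    by (simp add: L_def poly_prod algebra_simps)
  have poly_R: "poly R z = (\<Prod>i<d. z - x i) +
      (\<Sum>k<d. poly p (x k) * (\<Prod>i\<in>{..<d} - {k}. v k i * (z - x i)))" for z
    by (simp add: R_def poly_sum poly_B poly_L)
  have inj: "inj_on x {..<d}"
    by (rule inj_onI, rule ccontr) (use inv in force)
  have deg_B: "degree B = d" unfolding B_def
    by (subst degree_prod_eq_sum_degree) auto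
  have "lead_coeff B = 1" unfolding B_def lead_coeff_prod by simp
  hence lc_B: "coeff B d = 1" by (simp add: deg_B)
  have deg_L: "degree (L k) < d" if "k < d" for k
  proof -
    have "degree (L k) \<le> (\<Sum>i\<in>{..<d} - {k}. degree (smult (v k i) [:- x i, 1:]))"
      unfolding L_def
      using degree_prod_sum_le[of "{..<d} - {k}" "\<lambda>i. smult (v k i) [:- x i, 1:]"]
      unfolding comp_def by blast
    also have "\<dots> \<le> (\<Sum>i\<in>{..<d} - {k}. 1)"
      by (intro sum_mono order.trans[OF degree_smult_le]) simp
    also have "\<dots> < d" using that by simp
    finally show ?thesis .
  qed
  have "p = R"
  proof (rule poly_eqI_degree_lead_coeff[where A = "x ` {..<d}" and n = d])
    have "coeff (\<Sum>k<d. smult (poly p (x k)) (L k)) d = 0"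
      by (simp add: coeff_sum deg_L coeff_eq_0)
    thus "coeff p d = coeff R d" using p by (simp add: R_def lc_B)
    show "degree R \<le> d" unfolding R_def
      by (intro degree_add_le degree_sum_le order.trans[OF degree_smult_le])
         (auto simp: deg_B less_imp_le deg_L)
    show "d \<le> card (x ` {..<d})" using inj by (simp add: card_image)
  next
    fix z assume "z \<in> x ` {..<d}"
    then obtain j where j: "j < d" "z = x j" by auto
    have "(\<Sum>k<d. poly p (x k) * (\<Prod>i\<in>{..<d} - {k}. v k i * (z - x i))) =
          (\<Sum>k\<in>{j}. poly p (x k) * (\<Prod>i\<in>{..<d} - {k}. v k i * (z - x i)))"
      using j by (intro sum.mono_neutral_right) (auto simp: prod_zero_iff)
    also have "\<dots> = poly p z" using j inv by simp
    finally show "poly p z = poly R z" using j by (auto simp: poly_R prod_zero_iff)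
  qed (use p in simp)
  show ?thesis using poly_R[of t] unfolding \<open>p = R\<close>[symmetric] .
qed

section \<open>Embedding constants\<close>

lemma K_const_0: "K_const 0 = 0"
  and K_const_1: "K_const 1 = 1"
  and K_const_add: "K_const (a + b) = K_const a + K_const b"
  and K_const_diff: "K_const (a - b) = K_const a - K_const b"
  and K_const_mult: "K_const (a * b) = K_const a * K_const b"
  by (simp_all add: K_const_def single_add single_diff mult_single)

lemma K_const_eq_0_iff: "K_const a = 0 \<longleftrightarrow> a = 0"
  by (metis K_const_def lookup_single_eq lookup_zero single_zero)

lemma K_const_sum: "K_const (sum f S) = (\<Sum>i\<in>S. K_const (f i))"
  by (induction S rule: infinite_finite_induct) (simp_all add: K_const_0 K_const_add)

lemma K_const_prod: "K_const (prod f S) = (\<Prod>i\<in>S. K_const (f i))"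
  by (induction S rule: infinite_finite_induct) (simp_all add: K_const_1 K_const_mult)

lemma to_fract_power: "to_fract (a ^ n) = to_fract a ^ n"
  by (induction n) simp_all

lemma theta_power: "theta ^ n = to_fract (monom 1 n)"
  unfolding theta_def by (simp add: to_fract_power [symmetric] monom_altdef)

lemma theta_power_eq_iff: "(theta ^ m :: 'a::finite_field poly fract) = theta ^ n \<longleftrightarrow> m = n"
  unfolding theta_power to_fract_eq_iff by (metis degree_monom_eq zero_neq_one)

lemma theta_frobenius_eq_iff:
  "(theta ^ (CARD('a) ^ i) :: 'a::finite_field poly fract) = theta ^ (CARD('a) ^ j) \<longleftrightarrow> i = j"
  using finite_field_card_ge_2[where 'a='a] by (simp add: theta_power_eq_iff)

section \<open>Interpolating a monic polynomial at the conjugates of theta\<close>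

text \<open>
  Evaluating \<open>a\<close> at \<open>\<theta>^(q^k)\<close> is the same as raising \<open>a(\<theta>)\<close> to the power \<open>q^k\<close>, since this
  power is additive and fixes the coefficients of \<open>a\<close>.
\<close>
lemma subst_theta_frobenius:
  "subst_theta a (K_const (theta ^ (CARD('a) ^ k))) =
     K_const (to_fract (a :: 'a::finite_field poly) ^ (CARD('a) ^ k))"
proof (induction a)
  case 0
  show ?case using finite_field_card_ge_2[where 'a='a]
    by (simp add: subst_theta_def K_const_0 power_0_left)
next
  case (pCons c a)
  let ?N = "CARD('a) ^ k"
  have "[:c:] ^ ?N = [:c:]"
    using smult_power_card_power[of c 1 k] by simp
  moreover have "pCons c a = [:c:] + [:0, 1:] * a" by simp
  ultimately have "pCons c a ^ ?N = [:c:] + [:0, 1:] ^ ?N * a ^ ?N"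
    by (metis poly_add_power_card_power power_mult_distrib)
  hence "to_fract (pCons c a) ^ ?N = to_fract [:c:] + theta ^ ?N * to_fract a ^ ?N"
    by (simp add: theta_def flip: to_fract_power to_fract_add to_fract_mult)
  thus ?case using pCons.IH
    by (simp add: subst_theta_def map_poly_pCons K_const_0 K_const_add K_const_mult)
qed

text \<open>
  \<open>D\<^sub>k\<close> collects the differences with the nodes before \<open>\<theta>^(q^k)\<close>. The Frobenius twist of
  \<open>\<ell>\<^sub>j\<^sub>-\<^sub>k\<close> collects those with the later nodes up to \<open>j\<close>, because
  \<open>(\<theta> - \<theta>^(q^i))^(q^k) = \<theta>^(q^k) - \<theta>^(q^(i+k))\<close>. So the coefficients in \<open>Q\<^sub>d\<^sub>,\<^sub>k\<close> are those of a
  Newton form.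
\<close>
lemma carlitz_denominator_conv_prod:
  assumes "k \<le> j"
  shows "carlitz_D k * carlitz_ell (j - k) ^ (CARD('a) ^ k) =
    (\<Prod>i\<in>{..j} - {k}. theta ^ (CARD('a) ^ k) - theta ^ (CARD('a) ^ i) :: 'a::finite_field poly fract)"
proof -
  let ?q = "CARD('a)"
  let ?x = "\<lambda>i. theta ^ (?q ^ i) :: 'a poly fract"
  have "carlitz_ell (j - k) ^ (?q ^ k) = (\<Prod>i=1..j - k. ?x k - ?x (i + k))"
  proof -
    have "(theta - ?x i) ^ (?q ^ k) = ?x k - ?x (i + k)" for i
    proof -
      have "(theta - ?x i) ^ (?q ^ k) = to_fract (([:0, 1:] - monom 1 (?q ^ i)) ^ (?q ^ k))"
        by (simp add: to_fract_power theta_power) (simp add: theta_def)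
      also have "\<dots> = theta ^ (?q ^ k) - ?x i ^ (?q ^ k)"
        by (simp only: poly_diff_power_card_power to_fract_diff to_fract_power theta_power [symmetric])
           (simp only: theta_def)
      finally show ?thesis by (simp add: power_add power_mult)
    qed
    thus ?thesis by (simp add: carlitz_ell_def prod_power_distrib)
  qed
  also have "\<dots> = (\<Prod>i\<in>{k<..j}. ?x k - ?x i)"
    by (rule prod.reindex_bij_witness[of _ "\<lambda>i. i - k" "\<lambda>i. i + k"]) (use assms in auto)
  finally have "carlitz_D k * carlitz_ell (j - k) ^ (?q ^ k) =
      (\<Prod>i<k. ?x k - ?x i) * (\<Prod>i\<in>{k<..j}. ?x k - ?x i)"
    by (simp add: carlitz_D_def)
  also have "\<dots> = (\<Prod>i\<in>{..<k} \<union> {k<..j}. ?x k - ?x i)"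
    by (rule prod.union_disjoint [symmetric]) auto
  also have "{..<k} \<union> {k<..j} = {..j} - {k}" using assms by auto
  finally show ?thesis .
qed

lemma K_const_inverse_diff:
  assumes "i \<noteq> k"
  shows "K_const (1 / (theta ^ (CARD('a) ^ k) - theta ^ (CARD('a) ^ i))) *
    (K_const (theta ^ (CARD('a) ^ k)) - K_const (theta ^ (CARD('a) ^ i))) = (1 :: 'a::finite_field Kt)"
  using assms theta_frobenius_eq_iff[of k i, where 'a='a]
  by (simp add: K_const_1 flip: K_const_diff K_const_mult)

lemma Q_poly_conv_lagrange_basis:
  fixes t :: "'a::finite_field Kt"
  assumes "k < d"
  shows "Q_poly d k t = (\<Prod>i\<in>{..<d} - {k}.
    K_const (1 / (theta ^ (CARD('a) ^ k) - theta ^ (CARD('a) ^ i))) * (t - K_const (theta ^ (CARD('a) ^ i))))"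
proof -
  let ?x = "\<lambda>i. theta ^ (CARD('a) ^ i) :: 'a poly fract"
  have "Q_poly d k t = (\<Sum>j\<in>{k..<d}. (\<Prod>i\<in>{..j} - {k}. K_const (1 / (?x k - ?x i))) *
      (\<Prod>i<j. t - K_const (?x i)))"
    unfolding Q_poly_def b_poly_def
    by (intro sum.cong refl)
       (simp add: carlitz_denominator_conv_prod prod_dividef flip: K_const_prod)
  also have "\<dots> = (\<Prod>i\<in>{..<d} - {k}. K_const (1 / (?x k - ?x i)) * (t - K_const (?x i)))"
    by (rule newton_form_of_lagrange_basis) (use assms in \<open>simp_all add: K_const_inverse_diff\<close>)
  finally show ?thesis .
qed

lemma subst_theta_monic:
  fixes a :: "'a::finite_field poly"
  assumes "a \<in> monics d"
  shows "subst_theta a t =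
    (\<Sum>k<d. K_const (to_fract a ^ (CARD('a) ^ k)) * Q_poly d k t) + b_poly d t"
proof -
  let ?p = "map_poly (\<lambda>c. K_const (to_fract [:c:])) a"
  have deg: "degree ?p = d" using assms
    by (subst degree_map_poly) (auto simp: monics_def K_const_eq_0_iff)
  moreover have "lead_coeff ?p = 1" using assms deg
    by (auto simp: coeff_map_poly K_const_0 monics_def K_const_1 simp flip: one_pCons)
  ultimately have "poly ?p t = (\<Prod>i<d. t - K_const (theta ^ (CARD('a) ^ i))) +
      (\<Sum>k<d. poly ?p (K_const (theta ^ (CARD('a) ^ k))) * (\<Prod>i\<in>{..<d} - {k}.
        K_const (1 / (theta ^ (CARD('a) ^ k) - theta ^ (CARD('a) ^ i))) *
        (t - K_const (theta ^ (CARD('a) ^ i)))))"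
    by (rule monic_lagrange_interpolation) (rule K_const_inverse_diff)
  thus ?thesis
    by (simp add: b_poly_def Q_poly_conv_lagrange_basis subst_theta_frobenius
        flip: subst_theta_def)
qed

section \<open>The expansion of the twisted power sums\<close>

text \<open>
  The second alternative of the hypothesis is the bound on \<open>e = (\<Sum>i\<in>I. q^(k i))\<close> for a
  nonempty \<open>I\<close> with at most \<open>q - 1\<close> elements. It keeps \<open>e - (n + 1)\<close> below \<open>q^d - 1\<close>.
\<close>
lemma sum_monics_ratio:
  fixes e n d :: nat
  assumes "e \<le> n \<or> (d > 0 \<and> e \<le> (CARD('a) - 1) * CARD('a) ^ (d - 1))"
  shows "(\<Sum>a\<in>monics d. to_fract a ^ e / to_fract a ^ (n + 1)) =
    (if e \<le> n then power_sum d (n - e + 1) else 0 :: 'a::finite_field poly fract)"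
proof (cases "e \<le> n")
  case True
  have "to_fract a ^ e / to_fract a ^ (n + 1) = 1 / to_fract a ^ (n - e + 1)"
    if "a \<in> monics d" for a :: "'a poly"
  proof -
    have "to_fract a \<noteq> 0" using that by (auto simp: monics_def)
    moreover have "n + 1 = e + (n - e + 1)" using True by simp
    ultimately show ?thesis by (metis (no_types, lifting) div_by_1 divide_divide_eq_left
          divide_self power_add power_not_zero)
  qed
  thus ?thesis using True by (simp add: power_sum_def)
next
  case False
  let ?q = "CARD('a)" and ?m = "e - (n + 1)"
  from False assms have d: "d > 0" and e: "e \<le> (?q - 1) * ?q ^ (d - 1)" by auto
  have "?q ^ d = ?q * ?q ^ (d - 1)" using d by (simp add: power_eq_if)
  moreover have "?q ^ (d - 1) \<ge> 1" by simp
  moreover have "e \<le> ?q * ?q ^ (d - 1) - ?q ^ (d - 1)" using e by (simp add: diff_mult_distrib)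
  ultimately have m: "?m < ?q ^ d - 1" using False by linarith
  have "(\<Sum>a\<in>monics d. to_fract a ^ e / to_fract a ^ (n + 1)) =
        (\<Sum>a\<in>monics d. to_fract (a ^ ?m) :: 'a poly fract)"
  proof (rule sum.cong[OF refl])
    fix a :: "'a poly" assume "a \<in> monics d"
    hence "to_fract a \<noteq> 0" by (auto simp: monics_def)
    thus "to_fract a ^ e / to_fract a ^ (n + 1) = to_fract (a ^ ?m)"
      using False power_diff[of "to_fract a" "n + 1" e] by (simp add: to_fract_power)
  qed
  also have "\<dots> = 0"
    using sum_monics_power_eq_0[OF m] by (simp flip: to_fract_sum)
  finally show ?thesis using False by simp
qed

theorem proposition2p3:
  fixes \<Sigma> :: "nat set" and n d :: nat
  assumes "finite \<Sigma>" and "0 \<notin> \<Sigma>" and "card \<Sigma> < CARD('a::finite_field)"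
  shows "(power_sum_chi d \<Sigma> (n + 1) :: 'a Kt) =
           K_const (power_sum d (n + 1)) * b_prod d \<Sigma> +
           (\<Sum>(I, J) \<in> {(I, J). J \<subset> \<Sigma> \<and> I \<union> J = \<Sigma> \<and> I \<inter> J = {}}.
              \<Sum>k \<in> exponent_families CARD('a) d n I.
                K_const (power_sum d (n - (\<Sum>i\<in>I. CARD('a) ^ k i) + 1)) *
                (\<Prod>i\<in>I. Q_poly d (k i) (tvar i)) * b_prod d J)"
proof -
  let ?q = "CARD('a)"
  define F where "F I = I \<rightarrow>\<^sub>E {..<d}" for I :: "nat set"
  define e where "e I k = (\<Sum>i\<in>I. ?q ^ k i)" for I :: "nat set" and k :: "nat \<Rightarrow> nat"
  define G :: "nat set \<Rightarrow> (nat \<Rightarrow> nat) \<Rightarrow> 'a Kt"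
    where "G I k = (\<Prod>i\<in>I. Q_poly d (k i) (tvar i))" for I k
  \<comment> \<open>\<open>c m\<close> stands for \<open>S\<^sub>d(n + 1 - m)\<close>, where \<open>n + 1 - m\<close> may be zero or negative.\<close>
  define c :: "nat \<Rightarrow> 'a Kt"
    where "c m = K_const (\<Sum>a\<in>monics d. to_fract a ^ m / to_fract a ^ (n + 1))" for m
  define H :: "nat set \<Rightarrow> 'a Kt" where
    "H I = (\<Sum>k\<in>exponent_families ?q d n I.
              K_const (power_sum d (n - e I k + 1)) * G I k * b_prod d (\<Sigma> - I))" for I
  have chi: "chi \<Sigma> a = (\<Sum>I\<in>Pow \<Sigma>. \<Sum>k\<in>F I.
      K_const (to_fract a ^ e I k) * G I k * b_prod d (\<Sigma> - I))" if "a \<in> monics d" for a :: "'a poly"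
  proof -
    have "chi \<Sigma> a = (\<Sum>I\<in>Pow \<Sigma>.
        (\<Prod>i\<in>I. \<Sum>k<d. K_const (to_fract a ^ (?q ^ k)) * Q_poly d k (tvar i)) * b_prod d (\<Sigma> - I))"
      using assms(1) by (simp add: chi_def subst_theta_monic[OF that] prod_add b_prod_def)
    also have "\<dots> = (\<Sum>I\<in>Pow \<Sigma>. \<Sum>k\<in>F I.
      K_const (to_fract a ^ e I k) * G I k * b_prod d (\<Sigma> - I))"
    proof (rule sum.cong[OF refl])
      fix I assume "I \<in> Pow \<Sigma>"
      hence "finite I" using assms(1) by (auto intro: finite_subset)
      thus "(\<Prod>i\<in>I. \<Sum>k<d. K_const (to_fract a ^ (?q ^ k)) * Q_poly d k (tvar i)) * b_prod d (\<Sigma> - I) =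
          (\<Sum>k\<in>F I. K_const (to_fract a ^ e I k) * G I k * b_prod d (\<Sigma> - I))"
        by (simp add: prod_sum_PiE F_def e_def G_def power_sum K_const_prod prod.distrib sum_distrib_right)
    qed
    finally show ?thesis .
  qed
  have merge: "K_const (1 / y) * (K_const u * g * b) = K_const (u / y) * (g * b)"
    for y u :: "'a poly fract" and g b :: "'a Kt"
    by (simp flip: K_const_mult mult.assoc)
  have "power_sum_chi d \<Sigma> (n + 1) = (\<Sum>a\<in>monics d. \<Sum>I\<in>Pow \<Sigma>. \<Sum>k\<in>F I.
      K_const (to_fract a ^ e I k / to_fract a ^ (n + 1)) * (G I k * b_prod d (\<Sigma> - I)))"
    unfolding power_sum_chi_def
    by (intro sum.cong refl) (simp add: chi sum_distrib_left merge)
  also have "\<dots> = (\<Sum>I\<in>Pow \<Sigma>. \<Sum>k\<in>F I. c (e I k) * (G I k * b_prod d (\<Sigma> - I)))"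
    by (subst sum.swap, rule sum.cong[OF refl], subst sum.swap)
       (simp add: c_def K_const_sum sum_distrib_right)
  also have "\<dots> = (\<Sum>I\<in>Pow \<Sigma>. H I)"
  proof (rule sum.cong[OF refl])
    fix I assume "I \<in> Pow \<Sigma>"
    hence fin: "finite I" and card: "card I \<le> ?q - 1"
      using assms(1,3) card_mono[of \<Sigma> I] by (auto intro: finite_subset)
    have families: "exponent_families ?q d n I = {k \<in> F I. e I k \<le> n}"
    proof -
      have "int n - (\<Sum>i\<in>I. int (?q ^ k i)) + 1 > 0 \<longleftrightarrow> e I k \<le> n" for k
        unfolding e_def of_nat_sum [symmetric] by linarith
      thus ?thesis by (auto simp: exponent_families_def F_def)
    qed
    \<comment> \<open>The families in \<open>F I\<close> that violate the positivity condition contribute nothing.\<close>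
    have c: "c (e I k) = (if e I k \<le> n then K_const (power_sum d (n - e I k + 1)) else 0)"
      if k: "k \<in> F I" for k
    proof -
      have "e I k \<le> n \<or> (d > 0 \<and> e I k \<le> (?q - 1) * ?q ^ (d - 1))"
      proof (cases "I = {}")
        case False
        hence d: "d > 0" using k by (auto simp: F_def PiE_iff)
        have "e I k \<le> (\<Sum>i\<in>I. ?q ^ (d - 1))" unfolding e_def
          using k by (intro sum_mono power_increasing) (auto simp: F_def PiE_iff)
        also have "\<dots> \<le> (?q - 1) * ?q ^ (d - 1)" using card by simp
        finally show ?thesis using d by simp
      qed (simp add: e_def)
      from sum_monics_ratio[OF this] show ?thesis by (simp add: c_def K_const_0)
    qed
    have "finite (F I)" using fin by (simp add: F_def finite_PiE)
    thus "(\<Sum>k\<in>F I. c (e I k) * (G I k * b_prod d (\<Sigma> - I))) = H I"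
      unfolding H_def families
      by (intro sum.mono_neutral_cong_right) (auto simp: c mult_ac)
  qed
  also have "\<dots> = H {} + (\<Sum>I\<in>Pow \<Sigma> - {{}}. H I)"
    using assms(1) by (intro sum.remove) auto
  also have "H {} = K_const (power_sum d (n + 1)) * b_prod d \<Sigma>"
    by (simp add: H_def exponent_families_def e_def G_def)
  also have "(\<Sum>I\<in>Pow \<Sigma> - {{}}. H I) =
      (\<Sum>(I, J) \<in> {(I, J). J \<subset> \<Sigma> \<and> I \<union> J = \<Sigma> \<and> I \<inter> J = {}}.
        \<Sum>k \<in> exponent_families ?q d n I.
          K_const (power_sum d (n - e I k + 1)) * G I k * b_prod d J)"
    by (rule sum.reindex_bij_witness[of _ fst "\<lambda>I. (I, \<Sigma> - I)"]) (auto simp: H_def)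
  finally show ?thesis by (simp add: e_def G_def)
qed

end
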